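(* Let $p$ be a positive integer and $q\in(0,1)$. The function $$\Gamma_{p,q}(x)=\frac{[p]_q^{x}\,[p]_q!}{[x]_q[x+1]_q\cdots[x+p]_q},\qquad x>0,$$ is log-convex on $(0,\infty)$.
   Context: For $q\in(0,1)$ and real $x$, $[x]_q=\frac{1-q^x}{1-q}$, and for a positive integer $p$, $[p]_q!=[1]_q[2]_q\cdots[p]_q$. A positive function $f$ on $(0,\infty)$ is called log-convex if for all $\alpha,\beta>0$ with $\alpha+\beta=1$ and all $x,y>0$ one has $\log f(\alpha x+\beta y)\le \alpha\log f(x)+\beta\log f(y)$, equivalently $f(\alpha x+\beta y)\le f(x)^{\alpha}f(y)^{\beta}$. *)

theory Defs
  imports "HOL-Analysis.Analysis"
begin

definition q_number :: "real \<Rightarrow> real \<Rightarrow> real" where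
  "q_number q x = (1 - q powr x) / (1 - q)"

definition q_factorial :: "real \<Rightarrow> nat \<Rightarrow> real" where
  "q_factorial q p = (\<Prod>k=1..p. q_number q (real k))"

definition pq_Gamma :: "nat \<Rightarrow> real \<Rightarrow> real \<Rightarrow> real" where
  "pq_Gamma p q x =
     (q_number q (real p) powr x * q_factorial q p) / (\<Prod>k=0..p. q_number q (x + real k))"

(* Positivity on (0, infinity) is part of the notion: ln is total in HOL, so the
   inequality alone would not express log-convexity. *)
definition log_convex :: "(real \<Rightarrow> real) \<Rightarrow> bool" where
  "log_convex f \<longleftrightarrow>
     (\<forall>x>0. f x > 0) \<and>
     (\<forall>\<alpha>>0. \<forall>\<beta>>0. \<alpha> + \<beta> = 1 \<longrightarrow>
        (\<forall>x>0. \<forall>y>0. ln (f (\<alpha> * x + \<beta> * y)) \<le> \<alpha> * ln (f x) + \<beta> * ln (f y)))"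

lemma log_convex_iff_convex_on:
  "log_convex f \<longleftrightarrow> (\<forall>x>0. f x > 0) \<and> convex_on {0<..} (\<lambda>x. ln (f x))"
proof -
  have "convex_on {0<..} (\<lambda>x. ln (f x)) \<longleftrightarrow>
     (\<forall>\<alpha>>0. \<forall>\<beta>>0. \<alpha> + \<beta> = 1 \<longrightarrow>
        (\<forall>x>0. \<forall>y>0. ln (f (\<alpha> * x + \<beta> * y)) \<le> \<alpha> * ln (f x) + \<beta> * ln (f y)))"
    (is "_ \<longleftrightarrow> ?R")
  proof
    assume ?R
    show "convex_on {0<..} (\<lambda>x. ln (f x))"
      unfolding convex_on_def
    proof (intro conjI ballI allI impI)
      fix x y u v :: real
      assume *: "x \<in> {0<..}" "y \<in> {0<..}" "0 \<le> u" "0 \<le> v" "u + v = 1"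
      consider "u = 0" "v = 1" | "v = 0" "u = 1" | "u > 0" "v > 0"
        using * by linarith
      then show "ln (f (u *\<^sub>R x + v *\<^sub>R y)) \<le> u * ln (f x) + v * ln (f y)"
        using \<open>?R\<close> * by cases auto
    qed simp
  qed (auto simp: convex_on_def)
  then show ?thesis
    unfolding log_convex_def by blast
qed

end

theory Submission
  imports Defs
begin

text \<open>
  Each factor \<open>q_number q (x + k)\<close> in the denominator is concave in \<open>x\<close>, being a positive
  multiple of one minus the convex function \<open>q\<^sup>x\<close>. The logarithm is increasing and concave,
  so the logarithm of each factor is concave too (\<open>concave_on_ln_q_number_shift\<close>).
  Hence \<open>ln (pq_Gamma p q x)\<close> is an affine function of \<open>x\<close>, coming from the
  numerator, minus a sum of concave functions (\<open>ln_pq_Gamma\<close>), which makes it convex.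
\<close>

lemma q_number_pos:
  assumes "0 < q" "q < 1" "0 < x"
  shows "0 < q_number q x"
  using assms by (simp add: q_number_def powr01_less_one)

lemma concave_on_q_number:
  assumes "0 < q" "q < 1"
  shows "concave_on UNIV (q_number q)"
proof -
  \<comment> \<open>Convexity of \<open>q\<^sup>x\<close> is that of \<open>exp\<close> at \<open>x * ln q\<close>.\<close>
  have "q_number q (u * x + v * y) \<ge> u * q_number q x + v * q_number q y"
    if uv: "0 \<le> u" "0 \<le> v" "u + v = 1" for u v x y :: real
  proof -
    have "exp (u * (x * ln q) + v * (y * ln q)) \<le> u * exp (x * ln q) + v * exp (y * ln q)"
      using exp_convex uv by (simp add: convex_on_def)
    then have "q powr (u * x + v * y) \<le> u * q powr x + v * q powr y"
      using assms by (simp add: powr_def algebra_simps)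
    with uv have "u * (1 - q powr x) + v * (1 - q powr y) \<le> 1 - q powr (u * x + v * y)"
      by (simp add: algebra_simps)
    then have "(u * (1 - q powr x) + v * (1 - q powr y)) / (1 - q)
        \<le> (1 - q powr (u * x + v * y)) / (1 - q)"
      using assms by (intro divide_right_mono) auto
    then show ?thesis
      by (simp add: q_number_def add_divide_distrib)
  qed
  then show ?thesis
    by (simp add: concave_on_iff)
qed

text \<open>An increasing concave function, here \<open>ln\<close>, preserves concavity under composition.\<close>

lemma concave_on_ln_compose:
  fixes f :: "'a::real_vector \<Rightarrow> real"
  assumes conc: "concave_on S f" and pos: "\<And>x. x \<in> S \<Longrightarrow> 0 < f x"
  shows "concave_on S (\<lambda>x. ln (f x))"
  unfolding concave_on_iff
proof (intro conjI ballI allI impI)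
  show "convex S"
    using conc by (simp add: concave_on_iff)
  fix x y u v
  assume *: "x \<in> S" "y \<in> S" "0 \<le> u" "0 \<le> v" "u + v = (1::real)"
  have between: "u * f x + v * f y \<in> {0<..}"
    using * pos convexD[of "{0<..}" "f x" "f y" u v] by simp
  have "u * ln (f x) + v * ln (f y) \<le> ln (u * f x + v * f y)"
    using ln_concave * pos unfolding concave_on_iff by simp
  also have "\<dots> \<le> ln (f (u *\<^sub>R x + v *\<^sub>R y))"
    using conc * between unfolding concave_on_iff by (intro ln_mono) auto
  finally show "ln (f (u *\<^sub>R x + v *\<^sub>R y)) \<ge> u * ln (f x) + v * ln (f y)" .
qed

lemma concave_on_ln_q_number_shift:
  assumes "0 < q" "q < 1" "0 \<le> c"
  shows "concave_on {0<..} (\<lambda>x. ln (q_number q (x + c)))"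
proof (rule concave_on_ln_compose)
  show "concave_on {0<..} (\<lambda>x. q_number q (x + c))"
    unfolding concave_on_iff
  proof (intro conjI ballI allI impI)
    fix x y u v :: real
    assume uv: "0 \<le> u" "0 \<le> v" "u + v = 1"
    have "u *\<^sub>R x + v *\<^sub>R y + c = u * (x + c) + v * (y + c)"
      using arg_cong[OF uv(3), of "\<lambda>t. t * c"] by (simp add: algebra_simps)
    then show "q_number q (u *\<^sub>R x + v *\<^sub>R y + c)
        \<ge> u * q_number q (x + c) + v * q_number q (y + c)"
      using concave_on_q_number[OF assms(1,2)] uv unfolding concave_on_iff by simp
  qed simp
  show "0 < q_number q (x + c)" if "x \<in> {0<..}" for x
    using that assms by (simp add: q_number_pos)
qed

lemma q_factorial_pos:
  assumes "0 < q" "q < 1"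
  shows "0 < q_factorial q p"
  unfolding q_factorial_def using assms by (intro prod_pos) (auto intro: q_number_pos)

lemma pq_Gamma_pos:
  assumes "1 \<le> p" "0 < q" "q < 1" "0 < x"
  shows "0 < pq_Gamma p q x"
  unfolding pq_Gamma_def
  using assms q_number_pos[of q "real p"] q_factorial_pos[of q p]
  by (intro divide_pos_pos mult_pos_pos prod_pos) (auto intro: q_number_pos)

lemma ln_pq_Gamma:
  assumes "1 \<le> p" "0 < q" "q < 1" "0 < x"
  shows "ln (pq_Gamma p q x) =
    x * ln (q_number q (real p)) + ln (q_factorial q p)
      - (\<Sum>k=0..p. ln (q_number q (x + real k)))"
proof -
  have factor: "0 < q_number q (x + real k)" for k
    using assms by (intro q_number_pos) auto
  have "0 < q_number q (real p)" "0 < q_factorial q p"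
    using assms by (auto intro: q_number_pos q_factorial_pos)
  moreover have "ln (\<Prod>k=0..p. q_number q (x + real k)) = (\<Sum>k=0..p. ln (q_number q (x + real k)))"
    using factor by (intro ln_prod) (simp_all add: order_less_imp_not_eq2)
  ultimately show ?thesis
    using factor by (simp add: pq_Gamma_def ln_div ln_mult ln_powr order_less_imp_not_eq2)
qed

theorem theorem2p2:
  fixes p :: nat and q :: real
  assumes "p \<ge> 1" and "0 < q" and "q < 1"
  shows "log_convex (pq_Gamma p q)"
  unfolding log_convex_def
proof (intro conjI allI impI)
  show "0 < pq_Gamma p q x" if "0 < x" for x
    using pq_Gamma_pos assms that by blast
next
  fix a b x y :: real
  assume ab: "0 < a" "0 < b" "a + b = 1" and xy: "0 < x" "0 < y"
  let ?l = "\<lambda>k x. ln (q_number q (x + real k))"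
  let ?z = "a * x + b * y"
  have "(\<Sum>k=0..p. a * ?l k x + b * ?l k y) \<le> (\<Sum>k=0..p. ?l k ?z)"
    using concave_on_ln_q_number_shift[OF assms(2,3)] ab xy
    unfolding concave_on_iff by (intro sum_mono) simp
  then have denominator: "a * (\<Sum>k=0..p. ?l k x) + b * (\<Sum>k=0..p. ?l k y) \<le> (\<Sum>k=0..p. ?l k ?z)"
    by (simp add: sum.distrib sum_distrib_left)
  have affine: "?z * c + d = a * (x * c + d) + b * (y * c + d)" for c d
    using ab by (simp add: algebra_simps flip: distrib_right)
  have "0 < ?z"
    using ab xy by (simp add: add_pos_pos)
  then show "ln (pq_Gamma p q ?z) \<le> a * ln (pq_Gamma p q x) + b * ln (pq_Gamma p q y)"
    using denominator affine[of "ln (q_number q (real p))" "ln (q_factorial q p)"] assms xy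
    by (simp add: ln_pq_Gamma right_diff_distrib)
qed

end
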